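(* Let $P$ be a unital subsemigroup of a discrete group $G$ and let $X$ be a product system over $P$. Then the canonical $*$-epimorphism $\mathcal{T}(X)\to A\times_XP$ factors through the canonical $*$-epimorphism $\mathcal{T}(X)\to\mathcal{T}_{\mathrm{c}}^{\mathrm{F}}(X)$.
   Context: **Product systems.** $P$ is a unital discrete left-cancellative semigroup with unit $e$. A product system $X$ over $P$ is a family $\{X_p\}_{p\in P}$ of closed subspaces of some $\mathcal{B}(H)$ such that $A := X_e$ is a C*-algebra, $X_p\cdot X_q\subseteq X_{pq}$ and $X_p^*\cdot X_{pq}\subseteq X_q$ for all $p,q\in P$. Each $X_p$ is a C*-correspondence over $A$ with operations from $\mathcal{B}(H)$ and $\langle \xi,\eta\rangle=\xi^*\eta$; the left action is denoted $\varphi_p\colon A\to\mathcal{L}(X_p)$. **Representations.** A (Toeplitz) representation $t=\{t_p\}_{p\in P}$ of $X$ is a family of linear maps $t_p$ of $X_p$ into a common C*-algebra such that $t_e$ is a $*$-representation of $A$, $t_p(\xi_p)t_q(\xi_q)=t_{pq}(\xi_p\xi_q)$ and $t_p(\xi_p)^*t_{pq}(\xi_{pq})=t_q(\xi_p^*\xi_{pq})$. $\mathcal{T}(X)$ is the universal C*-algebra generated by $X$ with respect to representations of $X$; $t_*$ is the induced $*$-homomorphism of $\mathcal{T}(X)$ onto $\mathrm{C}^*(t)$, the C*-algebra generated by $t(X_p)$, $p\in P$. $\mathcal{T}(X)=\mathrm{C}^*(\tilde t)$ carries the coaction $\tilde t(\xi_p)\mapsto \tilde t(\xi_p)\otimes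 u_p\in\mathcal{T}(X)\otimes\mathrm{C}^*_{\max}(G)$ of $G$, where $u_g$ are the generators of $\mathrm{C}^*_{\max}(G)$ and $\otimes$ is spatial; $[\mathcal{T}(X)]_g$ denotes the space of elements mapped to $x\otimes u_g$. Similar notation is used for other C*-algebras with a coaction. **Fock covariance.** $\mathcal{F}X=\bigoplus_{r\in P}X_r$ (right Hilbert $A$-module), and $\lambda(\xi_p)\eta_r=\xi_p\eta_r$ defines an injective representation $\lambda$ of $X$ by adjointable operators; $\mathcal{T}_\lambda(X)=\mathrm{C}^*(\lambda)$, with coaction $\lambda(\xi_p)\mapsto\lambda(\xi_p)\otimes u_p$. $\mathcal{T}_{\mathrm{c}}^{\mathrm{F}}(X)$ is the quotient of $\mathcal{T}(X)$ by the ideal generated by $\ker\lambda_*\cap[\mathcal{T}(X)]_e$. **Strong covariance.** For finite $F\subseteq G$ let $K_F=\bigcap_{g\in F}gP$. For $r\in P$, $g\in G$ let $I_{r^{-1}K_{\{r,g\}}}=\bigcap_{s\in K_{\{r,g\}}}\ker\varphi_{r^{-1}s}$ if $K_{\{r,g\}}\neq\emptyset$ and $r\notin K_{\{r,g\}}$, and $I_{r^{-1}K_{\{r,g\}}}=A$ otherwise. Let $I_{r^{-1}(r\vee F)}=\bigcap_{g\in F}I_{r^{-1}K_{\{r,g\}}}$ ($=A$ if $F=\emptyset$) and $X_F=\bigoplus_{r\in P}X_rI_{r^{-1}(r\vee F)}\subseteq\mathcal{F}X$, which is invariant under $[\mathcal{T}_\lambda(X)]_e$. Let $\mathcal{I}_{\mathrm{sc},e}$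 be the set of $b\in[\mathcal{T}(X)]_e$ with $\lim_F\|\lambda_*(b)|_{X_F}\|=0$ along the finite subsets $F$ of $G$ directed by inclusion. $A\times_XP$ is the quotient of $\mathcal{T}(X)$ by the ideal generated by $\mathcal{I}_{\mathrm{sc},e}$. *)

theory Defs
  imports "HOL-Analysis.Analysis" "HOL-Algebra.Coset"
begin

section \<open>C*-algebras\<close>

text \<open>C*-algebras, not necessarily unital, as structures on a carrier set.\<close>

record 'a calg = "'a partial_object" +
  czero :: 'a
  cadd :: "'a \<Rightarrow> 'a \<Rightarrow> 'a"
  cscale :: "complex \<Rightarrow> 'a \<Rightarrow> 'a"
  cmult :: "'a \<Rightarrow> 'a \<Rightarrow> 'a"
  cstar :: "'a \<Rightarrow> 'a"
  cnorm :: "'a \<Rightarrow> real"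

definition cdist :: "('a, 'z) calg_scheme \<Rightarrow> 'a \<Rightarrow> 'a \<Rightarrow> real" where
  "cdist B x y = cnorm B (cadd B x (cscale B (-1) y))"

definition cconv :: "('a, 'z) calg_scheme \<Rightarrow> (nat \<Rightarrow> 'a) \<Rightarrow> 'a \<Rightarrow> bool" where
  "cconv B f x \<longleftrightarrow> (\<lambda>n. cdist B (f n) x) \<longlonglongrightarrow> 0"

definition ccauchy :: "('a, 'z) calg_scheme \<Rightarrow> (nat \<Rightarrow> 'a) \<Rightarrow> bool" where
  "ccauchy B f \<longleftrightarrow> (\<forall>e>0. \<exists>N. \<forall>m\<ge>N. \<forall>n\<ge>N. cdist B (f m) (f n) < e)"

text \<open>Additive inverses need no axiom of their own: they are the multiples by \<open>-1\<close>.\<close>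

locale cstar_algebra =
  fixes B :: "('a, 'z) calg_scheme"
  assumes zero_closed: "czero B \<in> carrier B"
    and add_closed: "\<lbrakk>x \<in> carrier B; y \<in> carrier B\<rbrakk> \<Longrightarrow> cadd B x y \<in> carrier B"
    and scale_closed: "x \<in> carrier B \<Longrightarrow> cscale B c x \<in> carrier B"
    and mult_closed: "\<lbrakk>x \<in> carrier B; y \<in> carrier B\<rbrakk> \<Longrightarrow> cmult B x y \<in> carrier B"
    and star_closed: "x \<in> carrier B \<Longrightarrow> cstar B x \<in> carrier B"
    and add_assoc: "\<lbrakk>x \<in> carrier B; y \<in> carrier B; z \<in> carrier B\<rbrakk>
          \<Longrightarrow> cadd B (cadd B x y) z = cadd B x (cadd B y z)"
    and add_comm: "\<lbrakk>x \<in> carrier B; y \<in> carrier B\<rbrakk> \<Longrightarrow> cadd B x y = cadd B y x"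
    and add_zero: "x \<in> carrier B \<Longrightarrow> cadd B x (czero B) = x"
    and scale_add: "\<lbrakk>x \<in> carrier B; y \<in> carrier B\<rbrakk>
          \<Longrightarrow> cscale B c (cadd B x y) = cadd B (cscale B c x) (cscale B c y)"
    and add_scale: "x \<in> carrier B
          \<Longrightarrow> cscale B (c + d) x = cadd B (cscale B c x) (cscale B d x)"
    and scale_scale: "x \<in> carrier B \<Longrightarrow> cscale B c (cscale B d x) = cscale B (c * d) x"
    and scale_one: "x \<in> carrier B \<Longrightarrow> cscale B 1 x = x"
    and scale_zero: "x \<in> carrier B \<Longrightarrow> cscale B 0 x = czero B"
    and mult_assoc: "\<lbrakk>x \<in> carrier B; y \<in> carrier B; z \<in> carrier B\<rbrakk>
          \<Longrightarrow> cmult B (cmult B x y) z = cmult B x (cmult B y z)"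
    and mult_add: "\<lbrakk>x \<in> carrier B; y \<in> carrier B; z \<in> carrier B\<rbrakk>
          \<Longrightarrow> cmult B x (cadd B y z) = cadd B (cmult B x y) (cmult B x z)"
    and add_mult: "\<lbrakk>x \<in> carrier B; y \<in> carrier B; z \<in> carrier B\<rbrakk>
          \<Longrightarrow> cmult B (cadd B x y) z = cadd B (cmult B x z) (cmult B y z)"
    and mult_scale: "\<lbrakk>x \<in> carrier B; y \<in> carrier B\<rbrakk>
          \<Longrightarrow> cmult B x (cscale B c y) = cscale B c (cmult B x y)"
    and scale_mult: "\<lbrakk>x \<in> carrier B; y \<in> carrier B\<rbrakk>
          \<Longrightarrow> cmult B (cscale B c x) y = cscale B c (cmult B x y)"
    and star_star: "x \<in> carrier B \<Longrightarrow> cstar B (cstar B x) = x"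
    and star_add: "\<lbrakk>x \<in> carrier B; y \<in> carrier B\<rbrakk>
          \<Longrightarrow> cstar B (cadd B x y) = cadd B (cstar B x) (cstar B y)"
    and star_scale: "x \<in> carrier B \<Longrightarrow> cstar B (cscale B c x) = cscale B (cnj c) (cstar B x)"
    and star_mult: "\<lbrakk>x \<in> carrier B; y \<in> carrier B\<rbrakk>
          \<Longrightarrow> cstar B (cmult B x y) = cmult B (cstar B y) (cstar B x)"
    and norm_nonneg: "x \<in> carrier B \<Longrightarrow> 0 \<le> cnorm B x"
    and norm_eq_zero: "x \<in> carrier B \<Longrightarrow> cnorm B x = 0 \<longleftrightarrow> x = czero B"
    and norm_scale: "x \<in> carrier B \<Longrightarrow> cnorm B (cscale B c x) = cmod c * cnorm B x"
    and norm_triangle: "\<lbrakk>x \<in> carrier B; y \<in> carrier B\<rbrakk>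
          \<Longrightarrow> cnorm B (cadd B x y) \<le> cnorm B x + cnorm B y"
    and norm_mult: "\<lbrakk>x \<in> carrier B; y \<in> carrier B\<rbrakk>
          \<Longrightarrow> cnorm B (cmult B x y) \<le> cnorm B x * cnorm B y"
    and cstar_identity: "x \<in> carrier B \<Longrightarrow> cnorm B (cmult B (cstar B x) x) = (cnorm B x)\<^sup>2"
    and complete: "\<lbrakk>range f \<subseteq> carrier B; ccauchy B f\<rbrakk> \<Longrightarrow> \<exists>x\<in>carrier B. cconv B f x"

definition star_hom ::
    "('a, 'y) calg_scheme \<Rightarrow> ('b, 'z) calg_scheme \<Rightarrow> ('a \<Rightarrow> 'b) \<Rightarrow> bool" where
  "star_hom A B f \<longleftrightarrow>
     (\<forall>x\<in>carrier A. f x \<in> carrier B \<and> f (cstar A x) = cstar B (f x) \<and>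
        (\<forall>c. f (cscale A c x) = cscale B c (f x)) \<and>
        (\<forall>y\<in>carrier A. f (cadd A x y) = cadd B (f x) (f y) \<and>
                        f (cmult A x y) = cmult B (f x) (f y)))"

definition closed_subspace :: "('a, 'z) calg_scheme \<Rightarrow> 'a set \<Rightarrow> bool" where
  "closed_subspace B S \<longleftrightarrow> S \<subseteq> carrier B \<and> czero B \<in> S \<and>
     (\<forall>x\<in>S. (\<forall>c. cscale B c x \<in> S) \<and> (\<forall>y\<in>S. cadd B x y \<in> S)) \<and>
     (\<forall>f. \<forall>x\<in>carrier B. range f \<subseteq> S \<and> cconv B f x \<longrightarrow> x \<in> S)"

definition cstar_subalgebra :: "('a, 'z) calg_scheme \<Rightarrow> 'a set \<Rightarrow> bool" where
  "cstar_subalgebra B S \<longleftrightarrow> closed_subspace B S \<and>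
     (\<forall>x\<in>S. cstar B x \<in> S \<and> (\<forall>y\<in>S. cmult B x y \<in> S))"

definition cstar_gen :: "('a, 'z) calg_scheme \<Rightarrow> 'a set \<Rightarrow> 'a set" where
  "cstar_gen B S = \<Inter>{C. cstar_subalgebra B C \<and> S \<subseteq> C}"

definition closed_ideal :: "('a, 'z) calg_scheme \<Rightarrow> 'a set \<Rightarrow> bool" where
  "closed_ideal B I \<longleftrightarrow> closed_subspace B I \<and>
     (\<forall>x\<in>carrier B. \<forall>i\<in>I. cmult B x i \<in> I \<and> cmult B i x \<in> I)"

definition ideal_gen :: "('a, 'z) calg_scheme \<Rightarrow> 'a set \<Rightarrow> 'a set" where
  "ideal_gen B S = \<Inter>{I. closed_ideal B I \<and> S \<subseteq> I}"

text \<open>The quotient by a closed ideal consists of cosets; \<open>cquot_map\<close> is the quotient map.\<close>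

definition cquot_map :: "('a, 'z) calg_scheme \<Rightarrow> 'a set \<Rightarrow> 'a \<Rightarrow> 'a set" where
  "cquot_map B I x = cadd B x ` I"

definition cquot :: "('a, 'z) calg_scheme \<Rightarrow> 'a set \<Rightarrow> 'a set calg" where
  "cquot B I =
    \<lparr> carrier = cquot_map B I ` carrier B,
      czero = I,
      cadd = (\<lambda>M N. \<Union>x\<in>M. \<Union>y\<in>N. cquot_map B I (cadd B x y)),
      cscale = (\<lambda>c M. \<Union>x\<in>M. cquot_map B I (cscale B c x)),
      cmult = (\<lambda>M N. \<Union>x\<in>M. \<Union>y\<in>N. cquot_map B I (cmult B x y)),
      cstar = (\<lambda>M. \<Union>x\<in>M. cquot_map B I (cstar B x)),
      cnorm = (\<lambda>M. Inf (cnorm B ` M)) \<rparr>"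


section \<open>Hilbert spaces and bounded operators\<close>

class chilbert_space = banach +
  fixes scaleC :: "complex \<Rightarrow> 'a \<Rightarrow> 'a"  (infixr "*\<^sub>C" 75)
    and cinner :: "'a \<Rightarrow> 'a \<Rightarrow> complex"
  assumes scaleC_add_right: "c *\<^sub>C (x + y) = c *\<^sub>C x + c *\<^sub>C y"
    and scaleC_add_left: "(c + d) *\<^sub>C x = c *\<^sub>C x + d *\<^sub>C x"
    and scaleC_scaleC: "c *\<^sub>C (d *\<^sub>C x) = (c * d) *\<^sub>C x"
    and scaleC_of_real: "complex_of_real r *\<^sub>C x = r *\<^sub>R x"
    and cinner_add_left: "cinner (x + y) z = cinner x z + cinner y z"
    and cinner_scaleC_left: "cinner (c *\<^sub>C x) y = c * cinner x y"
    and cinner_commute: "cinner x y = cnj (cinner y x)"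
    and cinner_self: "cinner x x = complex_of_real ((norm x)\<^sup>2)"

text \<open>The library type of bounded operators only imposes real linearity, so the algebra of all
  bounded operators of the Hilbert space is the set of complex linear elements of that type.
  The real and the complex operator norm of such an element agree.\<close>

definition clin_ops :: "('h::chilbert_space \<Rightarrow>\<^sub>L 'h) set" where
  "clin_ops = {S. \<forall>c x. blinfun_apply S (c *\<^sub>C x) = c *\<^sub>C blinfun_apply S x}"

definition op_scale :: "complex \<Rightarrow> ('h::chilbert_space \<Rightarrow>\<^sub>L 'h) \<Rightarrow> 'h \<Rightarrow>\<^sub>L 'h" where
  "op_scale c S = Blinfun (\<lambda>x. c *\<^sub>C blinfun_apply S x)"

definition adj :: "('h::chilbert_space \<Rightarrow>\<^sub>L 'h) \<Rightarrow> 'h \<Rightarrow>\<^sub>L 'h" where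
  "adj S = (THE R. \<forall>x y. cinner (blinfun_apply S x) y = cinner x (blinfun_apply R y))"

definition bounded_ops :: "('h::chilbert_space \<Rightarrow>\<^sub>L 'h) calg" where
  "bounded_ops =
    \<lparr> carrier = clin_ops, czero = 0, cadd = (+), cscale = op_scale,
      cmult = (o\<^sub>L), cstar = adj, cnorm = norm \<rparr>"

definition faithful_rep ::
    "('a, 'z) calg_scheme \<Rightarrow> ('a \<Rightarrow> 'k::chilbert_space \<Rightarrow>\<^sub>L 'k) \<Rightarrow> bool" where
  "faithful_rep B \<pi> \<longleftrightarrow> star_hom B bounded_ops \<pi> \<and> inj_on \<pi> (carrier B)"


section \<open>Spatial tensor products\<close>

text \<open>The map \<open>ten\<close> exhibits \<open>'m\<close> as the Hilbert space tensor product of \<open>'k\<close> and \<open>'l\<close>. The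
  real span of the elementary tensors is their complex span, as they absorb complex scalars.\<close>

definition hilbert_tensor ::
    "('k::chilbert_space \<Rightarrow> 'l::chilbert_space \<Rightarrow> 'm::chilbert_space) \<Rightarrow> bool" where
  "hilbert_tensor ten \<longleftrightarrow>
     (\<forall>x x' y. ten (x + x') y = ten x y + ten x' y) \<and>
     (\<forall>x y y'. ten x (y + y') = ten x y + ten x y') \<and>
     (\<forall>c x y. ten (c *\<^sub>C x) y = c *\<^sub>C ten x y \<and> ten x (c *\<^sub>C y) = c *\<^sub>C ten x y) \<and>
     (\<forall>x x' y y'. cinner (ten x y) (ten x' y') = cinner x x' * cinner y y') \<and>
     closure (span {ten x y | x y. True}) = UNIV"

definition op_tensor ::
    "('k::chilbert_space \<Rightarrow> 'l::chilbert_space \<Rightarrow> 'm::chilbert_space)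
      \<Rightarrow> ('k \<Rightarrow>\<^sub>L 'k) \<Rightarrow> ('l \<Rightarrow>\<^sub>L 'l) \<Rightarrow> 'm \<Rightarrow>\<^sub>L 'm" where
  "op_tensor ten S R = (THE Q. Q \<in> clin_ops \<and>
     (\<forall>x y. blinfun_apply Q (ten x y) = ten (blinfun_apply S x) (blinfun_apply R y)))"

text \<open>The spatial tensor product of \<open>A\<close> and \<open>C\<close>, realised through (faithful) representations
  \<open>\<pi>\<close> and \<open>\<rho>\<close>; here \<open>a \<otimes> c\<close> is \<open>op_tensor ten (\<pi> a) (\<rho> c)\<close>.\<close>

definition spatial_tensor ::
    "('k::chilbert_space \<Rightarrow> 'l::chilbert_space \<Rightarrow> 'm::chilbert_space)
      \<Rightarrow> ('a, 'y) calg_scheme \<Rightarrow> ('a \<Rightarrow> 'k \<Rightarrow>\<^sub>L 'k)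
      \<Rightarrow> ('c, 'z) calg_scheme \<Rightarrow> ('c \<Rightarrow> 'l \<Rightarrow>\<^sub>L 'l) \<Rightarrow> ('m \<Rightarrow>\<^sub>L 'm) calg" where
  "spatial_tensor ten A \<pi> C \<rho> = bounded_ops
     \<lparr> carrier := cstar_gen bounded_ops
         {op_tensor ten (\<pi> a) (\<rho> c) | a c. a \<in> carrier A \<and> c \<in> carrier C} \<rparr>"


section \<open>The maximal group C*-algebra\<close>

definition unitary_rep ::
    "('g, 'x) monoid_scheme \<Rightarrow> ('c, 'z) calg_scheme \<Rightarrow> ('g \<Rightarrow> 'c) \<Rightarrow> bool" where
  "unitary_rep G C u \<longleftrightarrow>
     (\<forall>g\<in>carrier G. u g \<in> carrier C) \<and>
     (\<forall>x\<in>carrier C. cmult C (u \<one>\<^bsub>G\<^esub>) x = x \<and> cmult C x (u \<one>\<^bsub>G\<^esub>) = x) \<and>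
     (\<forall>g\<in>carrier G. cmult C (cstar C (u g)) (u g) = u \<one>\<^bsub>G\<^esub> \<and>
                     cmult C (u g) (cstar C (u g)) = u \<one>\<^bsub>G\<^esub>) \<and>
     (\<forall>g\<in>carrier G. \<forall>h\<in>carrier G. u (g \<otimes>\<^bsub>G\<^esub> h) = cmult C (u g) (u h))"

text \<open>\<open>C\<close> is generated by a universal unitary representation \<open>u\<close> of \<open>G\<close>. HOL formulas cannot
  quantify over types, so the target algebras in the universal property live on one fixed type.
  This is no restriction: a C*-algebra generated by a unitary representation of \<open>G\<close> has at most
  \<open>max |G| |\<complex>| ^ \<aleph>\<^sub>0\<close> elements, hence a copy with carrier inside the type \<open>('g \<Rightarrow> complex) \<Rightarrow>
  'g \<Rightarrow> complex\<close>.\<close>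

definition max_group_cstar ::
    "('g, 'x) monoid_scheme \<Rightarrow> ('c, 'z) calg_scheme \<Rightarrow> ('g \<Rightarrow> 'c) \<Rightarrow> bool" where
  "max_group_cstar G C u \<longleftrightarrow>
     cstar_algebra C \<and> unitary_rep G C u \<and> cstar_gen C (u ` carrier G) = carrier C \<and>
     (\<forall>(B :: (('g \<Rightarrow> complex) \<Rightarrow> 'g \<Rightarrow> complex) calg) v.
        cstar_algebra B \<and> unitary_rep G B v \<longrightarrow>
        (\<exists>f. star_hom C B f \<and> (\<forall>g\<in>carrier G. f (u g) = v g)))"


section \<open>Product systems and their representations\<close>

text \<open>Only the values of \<open>X\<close> on \<open>P\<close> matter. Being closed under multiplication, \<open>X \<one>\<close> is a
  C*-algebra as soon as it is closed under adjoints. Left cancellation in \<open>P\<close> is automatic.\<close>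

definition product_system ::
    "('g, 'x) monoid_scheme \<Rightarrow> 'g set \<Rightarrow> ('g \<Rightarrow> ('h::chilbert_space \<Rightarrow>\<^sub>L 'h) set) \<Rightarrow> bool" where
  "product_system G P X \<longleftrightarrow>
     (\<forall>p\<in>P. closed_subspace bounded_ops (X p)) \<and>
     cstar_subalgebra bounded_ops (X \<one>\<^bsub>G\<^esub>) \<and>
     (\<forall>p\<in>P. \<forall>q\<in>P. \<forall>\<xi>\<in>X p. \<forall>\<eta>\<in>X q. \<xi> o\<^sub>L \<eta> \<in> X (p \<otimes>\<^bsub>G\<^esub> q)) \<and>
     (\<forall>p\<in>P. \<forall>q\<in>P. \<forall>\<xi>\<in>X p. \<forall>\<zeta>\<in>X (p \<otimes>\<^bsub>G\<^esub> q). adj \<xi> o\<^sub>L \<zeta> \<in> X q)"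

definition toeplitz_rep ::
    "('g, 'x) monoid_scheme \<Rightarrow> 'g set \<Rightarrow> ('g \<Rightarrow> ('h::chilbert_space \<Rightarrow>\<^sub>L 'h) set)
      \<Rightarrow> ('b, 'z) calg_scheme \<Rightarrow> ('g \<Rightarrow> ('h \<Rightarrow>\<^sub>L 'h) \<Rightarrow> 'b) \<Rightarrow> bool" where
  "toeplitz_rep G P X B t \<longleftrightarrow>
     (\<forall>p\<in>P. \<forall>\<xi>\<in>X p. t p \<xi> \<in> carrier B \<and>
        (\<forall>c. t p (op_scale c \<xi>) = cscale B c (t p \<xi>)) \<and>
        (\<forall>\<eta>\<in>X p. t p (\<xi> + \<eta>) = cadd B (t p \<xi>) (t p \<eta>))) \<and>
     star_hom (bounded_ops\<lparr>carrier := X \<one>\<^bsub>G\<^esub>\<rparr>) B (t \<one>\<^bsub>G\<^esub>) \<and>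
     (\<forall>p\<in>P. \<forall>q\<in>P. \<forall>\<xi>\<in>X p. \<forall>\<eta>\<in>X q.
        cmult B (t p \<xi>) (t q \<eta>) = t (p \<otimes>\<^bsub>G\<^esub> q) (\<xi> o\<^sub>L \<eta>)) \<and>
     (\<forall>p\<in>P. \<forall>q\<in>P. \<forall>\<xi>\<in>X p. \<forall>\<zeta>\<in>X (p \<otimes>\<^bsub>G\<^esub> q).
        cmult B (cstar B (t p \<xi>)) (t (p \<otimes>\<^bsub>G\<^esub> q) \<zeta>) = t q (adj \<xi> o\<^sub>L \<zeta>))"

text \<open>\<open>T\<close> is the universal C*-algebra generated by \<open>X\<close>, with universal representation \<open>tt\<close>. As
  for the group C*-algebra, the targets range over one type that is large enough: with \<open>N\<close> the
  number of elements of \<open>'g \<Rightarrow> 'h \<Rightarrow>\<^sub>L 'h\<close>, a C*-algebra generated by a representation of \<open>X\<close> has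
  at most \<open>N ^ \<aleph>\<^sub>0 \<le> N ^ N\<close> elements (and exactly one if the Hilbert space is zero). The operators
  on the Fock space have this very type.\<close>

definition toeplitz_algebra ::
    "('g, 'x) monoid_scheme \<Rightarrow> 'g set \<Rightarrow> ('g \<Rightarrow> ('h::chilbert_space \<Rightarrow>\<^sub>L 'h) set)
      \<Rightarrow> ('a, 'z) calg_scheme \<Rightarrow> ('g \<Rightarrow> ('h \<Rightarrow>\<^sub>L 'h) \<Rightarrow> 'a) \<Rightarrow> bool" where
  "toeplitz_algebra G P X T tt \<longleftrightarrow>
     cstar_algebra T \<and> toeplitz_rep G P X T tt \<and>
     cstar_gen T (\<Union>p\<in>P. tt p ` X p) = carrier T \<and>
     (\<forall>(B :: (('g \<Rightarrow> 'h \<Rightarrow>\<^sub>L 'h) \<Rightarrow> 'g \<Rightarrow> 'h \<Rightarrow>\<^sub>L 'h) calg) t.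
        cstar_algebra B \<and> toeplitz_rep G P X B t \<longrightarrow>
        (\<exists>f. star_hom T B f \<and> (\<forall>p\<in>P. \<forall>\<xi>\<in>X p. f (tt p \<xi>) = t p \<xi>)))"

text \<open>The homomorphism induced by a representation \<open>t\<close> of \<open>X\<close> in \<open>B\<close>; its values on \<open>T\<close> are
  uniquely determined because \<open>tt\<close> generates \<open>T\<close>.\<close>

definition induced ::
    "'g set \<Rightarrow> ('g \<Rightarrow> ('h::chilbert_space \<Rightarrow>\<^sub>L 'h) set)
      \<Rightarrow> ('a, 'y) calg_scheme \<Rightarrow> ('g \<Rightarrow> ('h \<Rightarrow>\<^sub>L 'h) \<Rightarrow> 'a)
      \<Rightarrow> ('b, 'z) calg_scheme \<Rightarrow> ('g \<Rightarrow> ('h \<Rightarrow>\<^sub>L 'h) \<Rightarrow> 'b) \<Rightarrow> 'a \<Rightarrow> 'b" where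
  "induced P X T tt B t =
     (SOME f. star_hom T B f \<and> (\<forall>p\<in>P. \<forall>\<xi>\<in>X p. f (tt p \<xi>) = t p \<xi>))"


section \<open>The coaction and its spectral subspaces\<close>

definition coaction ::
    "'g set \<Rightarrow> ('g \<Rightarrow> ('h::chilbert_space \<Rightarrow>\<^sub>L 'h) set)
      \<Rightarrow> ('a, 'y) calg_scheme \<Rightarrow> ('g \<Rightarrow> ('h \<Rightarrow>\<^sub>L 'h) \<Rightarrow> 'a)
      \<Rightarrow> ('c, 'z) calg_scheme \<Rightarrow> ('g \<Rightarrow> 'c)
      \<Rightarrow> ('k::chilbert_space \<Rightarrow> 'l::chilbert_space \<Rightarrow> 'm::chilbert_space)
      \<Rightarrow> ('a \<Rightarrow> 'k \<Rightarrow>\<^sub>L 'k) \<Rightarrow> ('c \<Rightarrow> 'l \<Rightarrow>\<^sub>L 'l) \<Rightarrow> 'a \<Rightarrow> 'm \<Rightarrow>\<^sub>L 'm" where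
  "coaction P X T tt C u ten \<pi> \<rho> =
     induced P X T tt (spatial_tensor ten T \<pi> C \<rho>)
       (\<lambda>p \<xi>. op_tensor ten (\<pi> (tt p \<xi>)) (\<rho> (u p)))"

definition spectral_subspace ::
    "'g set \<Rightarrow> ('g \<Rightarrow> ('h::chilbert_space \<Rightarrow>\<^sub>L 'h) set)
      \<Rightarrow> ('a, 'y) calg_scheme \<Rightarrow> ('g \<Rightarrow> ('h \<Rightarrow>\<^sub>L 'h) \<Rightarrow> 'a)
      \<Rightarrow> ('c, 'z) calg_scheme \<Rightarrow> ('g \<Rightarrow> 'c)
      \<Rightarrow> ('k::chilbert_space \<Rightarrow> 'l::chilbert_space \<Rightarrow> 'm::chilbert_space)
      \<Rightarrow> ('a \<Rightarrow> 'k \<Rightarrow>\<^sub>L 'k) \<Rightarrow> ('c \<Rightarrow> 'l \<Rightarrow>\<^sub>L 'l) \<Rightarrow> 'g \<Rightarrow> 'a set" where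
  "spectral_subspace P X T tt C u ten \<pi> \<rho> g =
     {x \<in> carrier T. coaction P X T tt C u ten \<pi> \<rho> x = op_tensor ten (\<pi> x) (\<rho> (u g))}"


section \<open>The Fock representation\<close>

definition fock_space ::
    "'g set \<Rightarrow> ('g \<Rightarrow> ('h::chilbert_space \<Rightarrow>\<^sub>L 'h) set) \<Rightarrow> ('g \<Rightarrow> 'h \<Rightarrow>\<^sub>L 'h) set" where
  "fock_space P X = {\<eta>. (\<forall>r\<in>P. \<eta> r \<in> X r) \<and> (\<forall>r. r \<notin> P \<longrightarrow> \<eta> r = 0) \<and>
     (\<lambda>r. adj (\<eta> r) o\<^sub>L \<eta> r) summable_on P}"

definition fock_inner ::
    "'g set \<Rightarrow> ('g \<Rightarrow> 'h::chilbert_space \<Rightarrow>\<^sub>L 'h) \<Rightarrow> ('g \<Rightarrow> 'h \<Rightarrow>\<^sub>L 'h) \<Rightarrow> 'h \<Rightarrow>\<^sub>L 'h" where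
  "fock_inner P \<eta> \<zeta> = (\<Sum>\<^sub>\<infinity>r\<in>P. adj (\<eta> r) o\<^sub>L \<zeta> r)"

definition fock_norm :: "'g set \<Rightarrow> ('g \<Rightarrow> 'h::chilbert_space \<Rightarrow>\<^sub>L 'h) \<Rightarrow> real" where
  "fock_norm P \<eta> = sqrt (norm (fock_inner P \<eta> \<eta>))"

text \<open>The operator norm of the restriction of \<open>S\<close> to a submodule \<open>Y\<close> of the Fock space.\<close>

definition restr_norm ::
    "'g set \<Rightarrow> ('g \<Rightarrow> 'h::chilbert_space \<Rightarrow>\<^sub>L 'h) set
      \<Rightarrow> (('g \<Rightarrow> 'h \<Rightarrow>\<^sub>L 'h) \<Rightarrow> 'g \<Rightarrow> 'h \<Rightarrow>\<^sub>L 'h) \<Rightarrow> real" where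
  "restr_norm P Y S = (SUP \<eta>\<in>{\<eta>\<in>Y. fock_norm P \<eta> \<le> 1}. fock_norm P (S \<eta>))"

definition is_fock_adjoint ::
    "'g set \<Rightarrow> ('g \<Rightarrow> ('h::chilbert_space \<Rightarrow>\<^sub>L 'h) set)
      \<Rightarrow> (('g \<Rightarrow> 'h \<Rightarrow>\<^sub>L 'h) \<Rightarrow> 'g \<Rightarrow> 'h \<Rightarrow>\<^sub>L 'h)
      \<Rightarrow> (('g \<Rightarrow> 'h \<Rightarrow>\<^sub>L 'h) \<Rightarrow> 'g \<Rightarrow> 'h \<Rightarrow>\<^sub>L 'h) \<Rightarrow> bool" where
  "is_fock_adjoint P X S R \<longleftrightarrow>
     (\<forall>\<eta>\<in>fock_space P X. \<forall>\<zeta>\<in>fock_space P X.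
        fock_inner P (S \<eta>) \<zeta> = fock_inner P \<eta> (R \<zeta>))"

definition fock_maps ::
    "'g set \<Rightarrow> ('g \<Rightarrow> ('h::chilbert_space \<Rightarrow>\<^sub>L 'h) set)
      \<Rightarrow> (('g \<Rightarrow> 'h \<Rightarrow>\<^sub>L 'h) \<Rightarrow> 'g \<Rightarrow> 'h \<Rightarrow>\<^sub>L 'h) set" where
  "fock_maps P X = {S. (\<forall>\<eta>\<in>fock_space P X. S \<eta> \<in> fock_space P X) \<and>
     (\<forall>\<eta>. \<eta> \<notin> fock_space P X \<longrightarrow> S \<eta> = (\<lambda>_. 0))}"

text \<open>The adjointable operators of the Fock space. They are extended by zero outside of it, so
  that each is a unique HOL function. Adjointable maps are automatically bounded and linear.\<close>

definition fock_ops ::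
    "'g set \<Rightarrow> ('g \<Rightarrow> ('h::chilbert_space \<Rightarrow>\<^sub>L 'h) set)
      \<Rightarrow> (('g \<Rightarrow> 'h \<Rightarrow>\<^sub>L 'h) \<Rightarrow> 'g \<Rightarrow> 'h \<Rightarrow>\<^sub>L 'h) calg" where
  "fock_ops P X =
    \<lparr> carrier = {S \<in> fock_maps P X. \<exists>R\<in>fock_maps P X. is_fock_adjoint P X S R},
      czero = (\<lambda>\<eta> r. 0),
      cadd = (\<lambda>S R \<eta> r. S \<eta> r + R \<eta> r),
      cscale = (\<lambda>c S \<eta> r. op_scale c (S \<eta> r)),
      cmult = (\<lambda>S R \<eta>. S (R \<eta>)),
      cstar = (\<lambda>S. THE R. R \<in> fock_maps P X \<and> is_fock_adjoint P X S R),
      cnorm = restr_norm P (fock_space P X) \<rparr>"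

text \<open>For \<open>s = p r\<close> with \<open>r \<in> P\<close>, the component at \<open>s\<close> of \<open>\<lambda>(\<xi>)\<eta>\<close> is \<open>\<xi> \<eta>\<^sub>r\<close>.\<close>

definition fock_rep ::
    "('g, 'x) monoid_scheme \<Rightarrow> 'g set \<Rightarrow> ('g \<Rightarrow> ('h::chilbert_space \<Rightarrow>\<^sub>L 'h) set)
      \<Rightarrow> 'g \<Rightarrow> ('h \<Rightarrow>\<^sub>L 'h) \<Rightarrow> ('g \<Rightarrow> 'h \<Rightarrow>\<^sub>L 'h) \<Rightarrow> 'g \<Rightarrow> 'h \<Rightarrow>\<^sub>L 'h" where
  "fock_rep G P X p \<xi> \<eta> =
     (\<lambda>s. if \<eta> \<in> fock_space P X \<and> s \<in> p <#\<^bsub>G\<^esub> P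
          then \<xi> o\<^sub>L \<eta> (inv\<^bsub>G\<^esub> p \<otimes>\<^bsub>G\<^esub> s) else 0)"

definition fock_star ::
    "('g, 'x) monoid_scheme \<Rightarrow> 'g set \<Rightarrow> ('g \<Rightarrow> ('h::chilbert_space \<Rightarrow>\<^sub>L 'h) set)
      \<Rightarrow> ('a, 'y) calg_scheme \<Rightarrow> ('g \<Rightarrow> ('h \<Rightarrow>\<^sub>L 'h) \<Rightarrow> 'a)
      \<Rightarrow> 'a \<Rightarrow> ('g \<Rightarrow> 'h \<Rightarrow>\<^sub>L 'h) \<Rightarrow> 'g \<Rightarrow> 'h \<Rightarrow>\<^sub>L 'h" where
  "fock_star G P X T tt = induced P X T tt (fock_ops P X) (fock_rep G P X)"


section \<open>Fock covariance\<close>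

text \<open>The Fock covariant algebra \<open>T\<^sub>c\<^sup>F(X)\<close> is \<open>cquot T\<close> of the following ideal.\<close>

definition fock_cov_ideal ::
    "('g, 'x) monoid_scheme \<Rightarrow> 'g set \<Rightarrow> ('g \<Rightarrow> ('h::chilbert_space \<Rightarrow>\<^sub>L 'h) set)
      \<Rightarrow> ('a, 'y) calg_scheme \<Rightarrow> ('g \<Rightarrow> ('h \<Rightarrow>\<^sub>L 'h) \<Rightarrow> 'a)
      \<Rightarrow> ('c, 'z) calg_scheme \<Rightarrow> ('g \<Rightarrow> 'c)
      \<Rightarrow> ('k::chilbert_space \<Rightarrow> 'l::chilbert_space \<Rightarrow> 'm::chilbert_space)
      \<Rightarrow> ('a \<Rightarrow> 'k \<Rightarrow>\<^sub>L 'k) \<Rightarrow> ('c \<Rightarrow> 'l \<Rightarrow>\<^sub>L 'l) \<Rightarrow> 'a set" where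
  "fock_cov_ideal G P X T tt C u ten \<pi> \<rho> = ideal_gen T
     {b \<in> spectral_subspace P X T tt C u ten \<pi> \<rho> \<one>\<^bsub>G\<^esub>.
        fock_star G P X T tt b = czero (fock_ops P X)}"


section \<open>Strong covariance\<close>

definition K_set :: "('g, 'x) monoid_scheme \<Rightarrow> 'g set \<Rightarrow> 'g set \<Rightarrow> 'g set" where
  "K_set G P F = (\<Inter>g\<in>F. g <#\<^bsub>G\<^esub> P)"

definition left_ker ::
    "('g, 'x) monoid_scheme \<Rightarrow> ('g \<Rightarrow> ('h::chilbert_space \<Rightarrow>\<^sub>L 'h) set)
      \<Rightarrow> 'g \<Rightarrow> ('h \<Rightarrow>\<^sub>L 'h) set" where
  "left_ker G X q = {a \<in> X \<one>\<^bsub>G\<^esub>. \<forall>\<xi>\<in>X q. a o\<^sub>L \<xi> = 0}"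

definition I_K ::
    "('g, 'x) monoid_scheme \<Rightarrow> 'g set \<Rightarrow> ('g \<Rightarrow> ('h::chilbert_space \<Rightarrow>\<^sub>L 'h) set)
      \<Rightarrow> 'g \<Rightarrow> 'g \<Rightarrow> ('h \<Rightarrow>\<^sub>L 'h) set" where
  "I_K G P X r g =
     (if K_set G P {r, g} \<noteq> {} \<and> r \<notin> K_set G P {r, g}
      then (\<Inter>s\<in>K_set G P {r, g}. left_ker G X (inv\<^bsub>G\<^esub> r \<otimes>\<^bsub>G\<^esub> s))
      else X \<one>\<^bsub>G\<^esub>)"

definition I_vee ::
    "('g, 'x) monoid_scheme \<Rightarrow> 'g set \<Rightarrow> ('g \<Rightarrow> ('h::chilbert_space \<Rightarrow>\<^sub>L 'h) set)
      \<Rightarrow> 'g \<Rightarrow> 'g set \<Rightarrow> ('h \<Rightarrow>\<^sub>L 'h) set" where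
  "I_vee G P X r F = X \<one>\<^bsub>G\<^esub> \<inter> (\<Inter>g\<in>F. I_K G P X r g)"

text \<open>A product \<open>X\<^sub>r I\<close> of spaces is the closed linear span of the elementary products (which, by
  Cohen factorisation, adds nothing when \<open>I\<close> is a closed ideal); the real span is already complex
  since \<open>X\<^sub>r\<close> is a complex space.\<close>

definition X_sub ::
    "('g, 'x) monoid_scheme \<Rightarrow> 'g set \<Rightarrow> ('g \<Rightarrow> ('h::chilbert_space \<Rightarrow>\<^sub>L 'h) set)
      \<Rightarrow> 'g set \<Rightarrow> ('g \<Rightarrow> 'h \<Rightarrow>\<^sub>L 'h) set" where
  "X_sub G P X F = {\<eta> \<in> fock_space P X. \<forall>r\<in>P.
     \<eta> r \<in> closure (span {\<xi> o\<^sub>L a | \<xi> a. \<xi> \<in> X r \<and> a \<in> I_vee G P X r F})}"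

definition I_sc ::
    "('g, 'x) monoid_scheme \<Rightarrow> 'g set \<Rightarrow> ('g \<Rightarrow> ('h::chilbert_space \<Rightarrow>\<^sub>L 'h) set)
      \<Rightarrow> ('a, 'y) calg_scheme \<Rightarrow> ('g \<Rightarrow> ('h \<Rightarrow>\<^sub>L 'h) \<Rightarrow> 'a)
      \<Rightarrow> ('c, 'z) calg_scheme \<Rightarrow> ('g \<Rightarrow> 'c)
      \<Rightarrow> ('k::chilbert_space \<Rightarrow> 'l::chilbert_space \<Rightarrow> 'm::chilbert_space)
      \<Rightarrow> ('a \<Rightarrow> 'k \<Rightarrow>\<^sub>L 'k) \<Rightarrow> ('c \<Rightarrow> 'l \<Rightarrow>\<^sub>L 'l) \<Rightarrow> 'a set" where
  "I_sc G P X T tt C u ten \<pi> \<rho> =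
     {b \<in> spectral_subspace P X T tt C u ten \<pi> \<rho> \<one>\<^bsub>G\<^esub>.
        ((\<lambda>F. restr_norm P (X_sub G P X F) (fock_star G P X T tt b)) \<longlongrightarrow> 0)
          (finite_subsets_at_top (carrier G))}"

text \<open>The covariance algebra \<open>A \<times>\<^sub>X P\<close> is \<open>cquot T\<close> of the following ideal.\<close>

definition strong_cov_ideal ::
    "('g, 'x) monoid_scheme \<Rightarrow> 'g set \<Rightarrow> ('g \<Rightarrow> ('h::chilbert_space \<Rightarrow>\<^sub>L 'h) set)
      \<Rightarrow> ('a, 'y) calg_scheme \<Rightarrow> ('g \<Rightarrow> ('h \<Rightarrow>\<^sub>L 'h) \<Rightarrow> 'a)
      \<Rightarrow> ('c, 'z) calg_scheme \<Rightarrow> ('g \<Rightarrow> 'c)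
      \<Rightarrow> ('k::chilbert_space \<Rightarrow> 'l::chilbert_space \<Rightarrow> 'm::chilbert_space)
      \<Rightarrow> ('a \<Rightarrow> 'k \<Rightarrow>\<^sub>L 'k) \<Rightarrow> ('c \<Rightarrow> 'l \<Rightarrow>\<^sub>L 'l) \<Rightarrow> 'a set" where
  "strong_cov_ideal G P X T tt C u ten \<pi> \<rho> = ideal_gen T (I_sc G P X T tt C u ten \<pi> \<rho>)"

end

theory Submission
  imports Defs
begin

text \<open>Both covariance algebras are quotients of \<open>T(X)\<close> by ideals generated inside the same spectral
  subspace. If \<open>\<lambda>\<^sub>*(b) = 0\<close>, then every restriction of \<open>\<lambda>\<^sub>*(b)\<close> to a submodule \<open>X\<^sub>F\<close> has norm zero, so
  the net of these norms tends to zero trivially. Hence the generators of the Fock covariance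
  ideal are among those of the strong covariance ideal, the first ideal \<open>I\<close> is contained in the
  second ideal \<open>J\<close>, and \<open>x + I \<mapsto> x + J\<close> is the required map.

  That this map respects adjoints presupposes that the quotients are *-algebras, that is, that a
  closed two-sided ideal of a C*-algebra is self-adjoint (\<open>closed_ideal_star\<close>). The usual proof
  goes through approximate units and spectral theory. Here it is obtained from the axioms of a
  C*-algebra by a mean ergodic argument. For \<open>x \<in> I\<close> let \<open>a = x\<^sup>*\<close>, scaled so that
  \<open>\<parallel>a\<parallel> < 1\<close>, and \<open>h = a\<^sup>* a \<in> I\<close>. A Cayley transform turns \<open>h\<close> into a unitary \<open>U = 1 + w\<close> with
  \<open>w \<in> I\<close>. The averages \<open>(1 + U + \<dots> + U\<^sup>N\<^sup>-\<^sup>1) / N\<close> lie in \<open>1 + I\<close> and are asymptotically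
  annihilated by \<open>U - 1 = w\<close>, therefore by \<open>h\<close>, therefore by left multiplication with \<open>a\<close>. So \<open>a\<close> is
  a limit of elements \<open>a f\<close> with \<open>f \<in> I\<close>, and these lie in \<open>I\<close>.\<close>

section \<open>Elementary calculus in a C*-algebra\<close>

context cstar_algebra
begin

abbreviation sum_B (infixl "\<boxplus>" 65) where "x \<boxplus> y \<equiv> cadd B x y"
abbreviation prod_B (infixl "\<boxdot>" 70) where "x \<boxdot> y \<equiv> cmult B x y"
abbreviation scale_B (infixr "\<cdot>" 75) where "c \<cdot> x \<equiv> cscale B c x"

lemmas closed = zero_closed add_closed scale_closed mult_closed star_closed

lemma add_left_comm:
  "\<lbrakk>x \<in> carrier B; y \<in> carrier B; z \<in> carrier B\<rbrakk> \<Longrightarrow> x \<boxplus> (y \<boxplus> z) = y \<boxplus> (x \<boxplus> z)"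
  by (metis add_assoc add_comm)

lemmas add_ac = add_assoc add_comm add_left_comm
lemmas distribs = mult_add add_mult mult_scale scale_mult scale_add scale_scale mult_assoc

lemma zero_add: "x \<in> carrier B \<Longrightarrow> czero B \<boxplus> x = x"
  by (metis add_comm add_zero zero_closed)

lemma add_neg: "x \<in> carrier B \<Longrightarrow> x \<boxplus> (-1) \<cdot> x = czero B"
  using add_scale[of x 1 "-1"] by (simp add: scale_one scale_zero)

lemma neg_add: "x \<in> carrier B \<Longrightarrow> (-1) \<cdot> x \<boxplus> x = czero B"
  by (metis add_neg add_comm scale_closed)

lemma add_cancel:
  assumes "x \<in> carrier B" "y \<in> carrier B" "z \<in> carrier B"
  shows "x \<boxplus> z = y \<boxplus> z \<longleftrightarrow> x = y"
  by (metis assms add_assoc add_neg add_zero scale_closed)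

lemma add_sub_cancel:
  assumes "x \<in> carrier B" "y \<in> carrier B"
  shows "(x \<boxplus> y) \<boxplus> (-1) \<cdot> y = x" "(y \<boxplus> x) \<boxplus> (-1) \<cdot> y = x"
proof -
  show *: "(x \<boxplus> y) \<boxplus> (-1) \<cdot> y = x"
    using add_assoc[of x y "(-1) \<cdot> y"] assms by (simp add: closed add_neg add_zero)
  show "(y \<boxplus> x) \<boxplus> (-1) \<cdot> y = x"
    using * add_comm[OF assms] by simp
qed

lemma scale_of_zero: "c \<cdot> czero B = czero B"
  by (metis scale_scale scale_zero mult_zero_right zero_closed)

lemma mult_zero_left_right:
  assumes "x \<in> carrier B"
  shows "czero B \<boxdot> x = czero B" "x \<boxdot> czero B = czero B"
  using scale_mult[OF zero_closed assms, of 0] mult_scale[OF assms zero_closed, of 0] assms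
  by (simp_all add: scale_zero closed)

lemma norm_zero: "cnorm B (czero B) = 0"
  using norm_eq_zero zero_closed by blast

lemma norm_star:
  assumes "x \<in> carrier B" shows "cnorm B (cstar B x) = cnorm B x"
proof -
  have le: "cnorm B y \<le> cnorm B (cstar B y)" if y: "y \<in> carrier B" for y
  proof (cases "cnorm B y = 0")
    case False
    have "cnorm B y * cnorm B y \<le> cnorm B (cstar B y) * cnorm B y"
      using norm_mult[OF star_closed[OF y] y] cstar_identity[OF y] by (simp add: power2_eq_square)
    with False show ?thesis
      using norm_nonneg[OF y] by (simp add: mult_le_cancel_right)
  qed (simp add: norm_nonneg closed y)
  show ?thesis
    using le[OF assms] le[OF star_closed[OF assms]] star_star[OF assms] by simp
qed

lemma norm_mult_star:
  assumes "x \<in> carrier B" shows "cnorm B (x \<boxdot> cstar B x) = (cnorm B x)\<^sup>2"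
  using cstar_identity[OF star_closed[OF assms]] by (simp add: assms star_star norm_star)

lemma cdist_commute:
  assumes "x \<in> carrier B" "y \<in> carrier B" shows "cdist B x y = cdist B y x"
proof -
  have "x \<boxplus> (-1) \<cdot> y = (-1) \<cdot> (y \<boxplus> (-1) \<cdot> x)"
    using assms by (simp add: scale_add scale_scale scale_one closed add_comm)
  then show ?thesis
    unfolding cdist_def using norm_scale[of "y \<boxplus> (-1) \<cdot> x" "-1"] assms by (simp add: closed)
qed

lemma cdist_eq_zero:
  assumes "x \<in> carrier B" "y \<in> carrier B" shows "cdist B x y = 0 \<longleftrightarrow> x = y"
proof -
  have "x \<boxplus> (-1) \<cdot> y = czero B \<longleftrightarrow> x = y"
    using add_cancel[of x y "(-1) \<cdot> y"] assms by (simp add: closed add_neg)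
  then show ?thesis
    unfolding cdist_def using assms by (simp add: norm_eq_zero closed)
qed

lemma cdist_triangle:
  assumes "x \<in> carrier B" "y \<in> carrier B" "z \<in> carrier B"
  shows "cdist B x z \<le> cdist B x y + cdist B y z"
proof -
  have "(x \<boxplus> (-1) \<cdot> y) \<boxplus> (y \<boxplus> (-1) \<cdot> z) = x \<boxplus> (((-1) \<cdot> y \<boxplus> y) \<boxplus> (-1) \<cdot> z)"
    using assms by (simp add: closed add_assoc)
  also have "\<dots> = x \<boxplus> (-1) \<cdot> z"
    using assms by (simp add: closed neg_add zero_add)
  finally show ?thesis
    unfolding cdist_def using norm_triangle[of "x \<boxplus> (-1) \<cdot> y" "y \<boxplus> (-1) \<cdot> z"] assms
    by (simp add: closed)
qed

lemma contraction_fixpoint: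
  assumes f: "\<And>x. x \<in> carrier B \<Longrightarrow> f x \<in> carrier B" and "k < 1"
    and contr: "\<And>x y. \<lbrakk>x \<in> carrier B; y \<in> carrier B\<rbrakk> \<Longrightarrow> cdist B (f x) (f y) \<le> k * cdist B x y"
  obtains x where "x \<in> carrier B" "f x = x"
proof -
  \<comment> \<open>The axioms of a metric space ask for nonnegativity and symmetry off the carrier as well.\<close>
  define d where "d x y = (if x \<in> carrier B \<and> y \<in> carrier B then cdist B x y else 0)" for x y
  interpret Metric_space "carrier B" d
    by unfold_locales
      (auto simp: d_def cdist_commute cdist_eq_zero cdist_triangle,
       auto simp: cdist_def closed norm_nonneg)
  have mcomplete
    unfolding mcomplete_def
  proof (intro allI impI)
    fix \<sigma> assume \<sigma>: "MCauchy \<sigma>"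
    then have r: "range \<sigma> \<subseteq> carrier B" by (simp add: MCauchy_def)
    then have \<sigma>B: "\<sigma> n \<in> carrier B" for n by auto
    have "ccauchy B \<sigma>"
      unfolding ccauchy_def
    proof (intro allI impI)
      fix e :: real assume "e > 0"
      then obtain N where "\<And>n m. N \<le> n \<Longrightarrow> N \<le> m \<Longrightarrow> d (\<sigma> n) (\<sigma> m) < e"
        using \<sigma> unfolding MCauchy_def by meson
      then show "\<exists>N. \<forall>m\<ge>N. \<forall>n\<ge>N. cdist B (\<sigma> m) (\<sigma> n) < e"
        using \<sigma>B unfolding d_def by auto
    qed
    then obtain x where "x \<in> carrier B" "cconv B \<sigma> x"
      using complete r by blast
    then show "\<exists>x. limitin mtopology \<sigma> x sequentially"
      using \<sigma>B unfolding limitin_metric_dist_null d_def cconv_def by auto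
  qed
  then show ?thesis
    using that f contr zero_closed
    by (elim Banach_fixedpoint_thm[of f k]) (auto simp: d_def \<open>k < 1\<close>)
qed

section \<open>Closed ideals are self-adjoint\<close>

text \<open>The relation below says that \<open>1 + w = (i - h)\<^sup>-\<^sup>1(i + h)\<close>, which for self-adjoint \<open>h\<close> is, up to
  sign and inversion, the Cayley transform of \<open>h\<close>. It has the form identity plus an element of the algebra, so
  it acts by multiplication even if the algebra has no unit. For small \<open>h\<close> the relation is the
  fixed point equation of a contraction.\<close>

lemma cayley_transform_exists:
  assumes h: "h \<in> carrier B" and small: "cnorm B h < 1"
  obtains w where "w \<in> carrier B" "h \<boxdot> w = \<i> \<cdot> w \<boxplus> (-2) \<cdot> h"
proof -
  define \<phi> where "\<phi> v = (- \<i>) \<cdot> (2 \<cdot> h \<boxplus> h \<boxdot> v)" for v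
  have "cdist B (\<phi> x) (\<phi> y) \<le> cnorm B h * cdist B x y" if x: "x \<in> carrier B" and y: "y \<in> carrier B" for x y
  proof -
    have "\<phi> x \<boxplus> (-1) \<cdot> \<phi> y
        = ((- 2 * \<i>) \<cdot> h \<boxplus> (-1) \<cdot> (- 2 * \<i>) \<cdot> h) \<boxplus> ((-\<i>) \<cdot> (h \<boxdot> x) \<boxplus> (-1) \<cdot> (-\<i>) \<cdot> (h \<boxdot> y))"
      unfolding \<phi>_def using h x y by (simp add: scale_add scale_scale closed add_ac mult.commute)
    also have "\<dots> = (-\<i>) \<cdot> (h \<boxdot> x) \<boxplus> (-1) \<cdot> (-\<i>) \<cdot> (h \<boxdot> y)"
      using h x y by (simp only: add_neg zero_add closed)
    also have "\<dots> = (-\<i>) \<cdot> (h \<boxdot> (x \<boxplus> (-1) \<cdot> y))"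
      using h x y by (simp add: distribs closed)
    finally have "cdist B (\<phi> x) (\<phi> y) = cnorm B (h \<boxdot> (x \<boxplus> (-1) \<cdot> y))"
      unfolding cdist_def using h x y by (simp add: norm_scale closed)
    also have "\<dots> \<le> cnorm B h * cdist B x y"
      unfolding cdist_def using h x y by (intro norm_mult) (auto simp: closed)
    finally show ?thesis .
  qed
  then obtain w where w: "w \<in> carrier B" "\<phi> w = w"
    using contraction_fixpoint[of \<phi> "cnorm B h"] small h by (auto simp: \<phi>_def closed)
  have "\<i> \<cdot> w = 2 \<cdot> h \<boxplus> h \<boxdot> w"
    using arg_cong[OF w(2), of "\<lambda>v. \<i> \<cdot> v"] h w(1) unfolding \<phi>_def
    by (simp add: scale_scale scale_one closed)
  then have "\<i> \<cdot> w \<boxplus> (-2) \<cdot> h = h \<boxdot> w \<boxplus> (2 \<cdot> h \<boxplus> (-1) \<cdot> 2 \<cdot> h)"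
    using h w(1) by (simp add: scale_scale closed add_ac)
  also have "\<dots> = h \<boxdot> w"
    using h w(1) by (simp only: add_neg add_zero closed)
  finally show ?thesis using that w(1) by metis
qed

text \<open>Multiplying the relation by \<open>w\<^sup>*\<close> and its adjoint by \<open>w\<close> gives two expressions for
  \<open>w\<^sup>* h w\<close>; equating them is the unitarity \<open>w\<^sup>* w + w\<^sup>* + w = 0\<close> of \<open>1 + w\<close>.\<close>

lemma cayley_transform_unitary:
  assumes h: "h \<in> carrier B" and sa: "cstar B h = h"
    and w: "w \<in> carrier B" and hw: "h \<boxdot> w = \<i> \<cdot> w \<boxplus> (-2) \<cdot> h"
  shows "cstar B w \<boxdot> w \<boxplus> cstar B w \<boxplus> w = czero B"
proof -
  define s where "s = cstar B w"
  have s: "s \<in> carrier B" by (simp add: s_def w closed)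
  have sh: "s \<boxdot> h = (-\<i>) \<cdot> s \<boxplus> (-2) \<cdot> h"
    using arg_cong[OF hw, of "cstar B"] h w
    by (simp add: s_def sa star_mult star_add star_scale closed)
  have "s \<boxdot> (h \<boxdot> w) = \<i> \<cdot> (s \<boxdot> w) \<boxplus> (2 * \<i>) \<cdot> s \<boxplus> 4 \<cdot> h"
    unfolding hw using s h w by (simp add: distribs closed sh add_assoc mult.commute)
  moreover have "s \<boxdot> (h \<boxdot> w) = (-\<i>) \<cdot> (s \<boxdot> w) \<boxplus> (- 2 * \<i>) \<cdot> w \<boxplus> 4 \<cdot> h"
  proof -
    have "s \<boxdot> (h \<boxdot> w) = (s \<boxdot> h) \<boxdot> w" using s h w by (simp add: mult_assoc)
    also have "\<dots> = (-\<i>) \<cdot> (s \<boxdot> w) \<boxplus> (- 2 * \<i>) \<cdot> w \<boxplus> 4 \<cdot> h"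
      unfolding sh using s h w by (simp add: distribs closed hw add_assoc)
    finally show ?thesis .
  qed
  ultimately have eq: "\<i> \<cdot> (s \<boxdot> w) \<boxplus> (2 * \<i>) \<cdot> s = (-\<i>) \<cdot> (s \<boxdot> w) \<boxplus> (- 2 * \<i>) \<cdot> w"
    using add_cancel s h w by (simp add: closed)
  have "(2 * \<i>) \<cdot> (s \<boxdot> w \<boxplus> s \<boxplus> w)
      = (\<i> \<cdot> (s \<boxdot> w) \<boxplus> (2 * \<i>) \<cdot> s) \<boxplus> (\<i> \<cdot> (s \<boxdot> w) \<boxplus> (2 * \<i>) \<cdot> w)"
    using s w add_scale[of "s \<boxdot> w" \<i> \<i>] by (simp add: scale_add closed add_ac)
  also have "\<dots> = (\<i> \<cdot> (s \<boxdot> w) \<boxplus> (-1) \<cdot> \<i> \<cdot> (s \<boxdot> w)) \<boxplus> ((2 * \<i>) \<cdot> w \<boxplus> (-1) \<cdot> (2 * \<i>) \<cdot> w)"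
    unfolding eq using s w by (simp add: scale_scale closed add_ac)
  also have "\<dots> = czero B"
    using s w by (simp only: add_neg add_zero closed)
  finally have "(- \<i> / 2) \<cdot> (2 * \<i>) \<cdot> (s \<boxdot> w \<boxplus> s \<boxplus> w) = czero B"
    by (simp add: scale_of_zero)
  then show ?thesis
    using s w by (simp add: scale_scale scale_one closed flip: s_def)
qed

text \<open>If \<open>1 + w\<close> is unitary, so that \<open>w\<^sup>* w + w\<^sup>* + w = 0\<close>, the C*-identity makes it act
  isometrically, since \<open>(y + w y)\<^sup>* (y + w y) = y\<^sup>* y\<close>.\<close>

lemma unitary_isometric:
  assumes w: "w \<in> carrier B" and unit: "cstar B w \<boxdot> w \<boxplus> cstar B w \<boxplus> w = czero B"
    and y: "y \<in> carrier B"
  shows "cnorm B (y \<boxplus> w \<boxdot> y) = cnorm B y"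
proof -
  have "cstar B (y \<boxplus> w \<boxdot> y) \<boxdot> (y \<boxplus> w \<boxdot> y)
      = cstar B y \<boxdot> y \<boxplus> cstar B y \<boxdot> ((cstar B w \<boxdot> w \<boxplus> cstar B w \<boxplus> w) \<boxdot> y)"
    using w y by (simp add: star_add star_mult distribs closed add_ac)
  also have "\<dots> = cstar B y \<boxdot> y"
    unfolding unit using y by (simp add: mult_zero_left_right add_zero closed)
  finally have "(cnorm B (y \<boxplus> w \<boxdot> y))\<^sup>2 = (cnorm B y)\<^sup>2"
    using cstar_identity[of y] cstar_identity[of "y \<boxplus> w \<boxdot> y"] w y by (simp add: closed)
  then show ?thesis
    using norm_nonneg w y by (simp add: closed)
qed

lemma closed_subspaceD:
  assumes "closed_subspace B I"
  shows "I \<subseteq> carrier B" "czero B \<in> I" "x \<in> I \<Longrightarrow> c \<cdot> x \<in> I"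
    "x \<in> I \<Longrightarrow> y \<in> I \<Longrightarrow> x \<boxplus> y \<in> I"
    "\<lbrakk>\<And>n. f n \<in> I; x \<in> carrier B; cconv B f x\<rbrakk> \<Longrightarrow> x \<in> I"
proof -
  note * = assms[unfolded closed_subspace_def]
  show "I \<subseteq> carrier B" "czero B \<in> I" "x \<in> I \<Longrightarrow> c \<cdot> x \<in> I"
    "x \<in> I \<Longrightarrow> y \<in> I \<Longrightarrow> x \<boxplus> y \<in> I"
    using * by blast+
  show "x \<in> I" if "\<And>n. f n \<in> I" "x \<in> carrier B" "cconv B f x"
    using * that by (meson image_subsetI)
qed

lemma closed_idealD:
  assumes "closed_ideal B I"
  shows "closed_subspace B I" "\<lbrakk>x \<in> carrier B; i \<in> I\<rbrakk> \<Longrightarrow> x \<boxdot> i \<in> I"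
    "\<lbrakk>x \<in> carrier B; i \<in> I\<rbrakk> \<Longrightarrow> i \<boxdot> x \<in> I"
  using assms unfolding closed_ideal_def by blast+

text \<open>The mean ergodic estimate for the isometry \<open>U y = y + w y\<close>. Here \<open>U\<^sup>N\<close> is \<open>1 + e\<close> and
  \<open>1 + U + \<dots> + U\<^sup>N\<^sup>-\<^sup>1\<close> is \<open>N + f\<close> with \<open>e\<close> and \<open>f\<close> in the ideal, and \<open>(U - 1)\<close> times the sum
  telescopes to \<open>U\<^sup>N - 1\<close>, which stays bounded.\<close>

lemma ergodic_sums:
  assumes I: "closed_ideal B I" and w: "w \<in> I"
    and iso: "\<And>y. y \<in> carrier B \<Longrightarrow> cnorm B (y \<boxplus> w \<boxdot> y) = cnorm B y"
  obtains f where "f \<in> I"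
    "\<forall>y\<in>carrier B. cnorm B (of_nat N \<cdot> y \<boxplus> f \<boxdot> y) \<le> real N * cnorm B y"
    "\<forall>y\<in>carrier B. cnorm B (w \<boxdot> (of_nat N \<cdot> y \<boxplus> f \<boxdot> y)) \<le> 2 * cnorm B y"
proof -
  note S = closed_subspaceD[OF closed_idealD(1)[OF I]]
  have IB: "x \<in> carrier B" if "x \<in> I" for x using S(1) that by blast
  have "\<exists>e\<in>I. \<exists>f\<in>I. \<forall>y\<in>carrier B. cnorm B (y \<boxplus> e \<boxdot> y) = cnorm B y
      \<and> cnorm B (of_nat N \<cdot> y \<boxplus> f \<boxdot> y) \<le> real N * cnorm B y
      \<and> w \<boxdot> (of_nat N \<cdot> y \<boxplus> f \<boxdot> y) = e \<boxdot> y"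
  proof (induction N)
    case 0
    show ?case
      using S(2) IB[OF w]
      by (intro bexI[of _ "czero B"])
        (auto simp: mult_zero_left_right scale_zero add_zero closed norm_zero)
  next
    case (Suc N)
    then obtain e f where e: "e \<in> I" and f: "f \<in> I"
      and *: "\<And>y. y \<in> carrier B \<Longrightarrow> cnorm B (y \<boxplus> e \<boxdot> y) = cnorm B y"
        "\<And>y. y \<in> carrier B \<Longrightarrow> cnorm B (of_nat N \<cdot> y \<boxplus> f \<boxdot> y) \<le> real N * cnorm B y"
        "\<And>y. y \<in> carrier B \<Longrightarrow> w \<boxdot> (of_nat N \<cdot> y \<boxplus> f \<boxdot> y) = e \<boxdot> y"
      by blast
    note [simp] = IB[OF e] IB[OF f] IB[OF w] closed
    define e' where "e' = e \<boxplus> w \<boxplus> w \<boxdot> e"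
    define f' where "f' = f \<boxplus> e"
    have "e' \<in> I" "f' \<in> I"
      unfolding e'_def f'_def using e f w S(4) closed_idealD(2)[OF I] by simp_all
    moreover have "cnorm B (y \<boxplus> e' \<boxdot> y) = cnorm B y
      \<and> cnorm B (of_nat (Suc N) \<cdot> y \<boxplus> f' \<boxdot> y) \<le> real (Suc N) * cnorm B y
      \<and> w \<boxdot> (of_nat (Suc N) \<cdot> y \<boxplus> f' \<boxdot> y) = e' \<boxdot> y" if y: "y \<in> carrier B" for y
    proof (intro conjI)
      note [simp] = y
      have "y \<boxplus> e' \<boxdot> y = (y \<boxplus> e \<boxdot> y) \<boxplus> w \<boxdot> (y \<boxplus> e \<boxdot> y)"
        unfolding e'_def by (simp add: distribs add_ac)
      then show "cnorm B (y \<boxplus> e' \<boxdot> y) = cnorm B y"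
        using iso[of "y \<boxplus> e \<boxdot> y"] *(1)[of y] by simp
      have split: "of_nat (Suc N) \<cdot> y \<boxplus> f' \<boxdot> y
          = (of_nat N \<cdot> y \<boxplus> f \<boxdot> y) \<boxplus> (y \<boxplus> e \<boxdot> y)"
        using add_scale[of y "of_nat N" 1]
        unfolding f'_def by (simp add: add.commute scale_one distribs add_ac)
      show "cnorm B (of_nat (Suc N) \<cdot> y \<boxplus> f' \<boxdot> y) \<le> real (Suc N) * cnorm B y"
        unfolding split
        using norm_triangle[of "of_nat N \<cdot> y \<boxplus> f \<boxdot> y" "y \<boxplus> e \<boxdot> y"] *(1,2)[of y]
        by (simp add: algebra_simps)
      have "w \<boxdot> (of_nat (Suc N) \<cdot> y \<boxplus> f' \<boxdot> y) = e \<boxdot> y \<boxplus> w \<boxdot> (y \<boxplus> e \<boxdot> y)"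
        unfolding split
        using *(3)[of y] mult_add[of w "of_nat N \<cdot> y \<boxplus> f \<boxdot> y" "y \<boxplus> e \<boxdot> y"] by simp
      also have "\<dots> = e' \<boxdot> y"
        unfolding e'_def by (simp add: distribs add_ac)
      finally show "w \<boxdot> (of_nat (Suc N) \<cdot> y \<boxplus> f' \<boxdot> y) = e' \<boxdot> y" .
    qed
    ultimately show ?case by blast
  qed
  then obtain e f where e: "e \<in> I" and f: "f \<in> I"
    and *: "\<And>y. y \<in> carrier B \<Longrightarrow> cnorm B (y \<boxplus> e \<boxdot> y) = cnorm B y"
      "\<And>y. y \<in> carrier B \<Longrightarrow> cnorm B (of_nat N \<cdot> y \<boxplus> f \<boxdot> y) \<le> real N * cnorm B y"
      "\<And>y. y \<in> carrier B \<Longrightarrow> w \<boxdot> (of_nat N \<cdot> y \<boxplus> f \<boxdot> y) = e \<boxdot> y"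
    by blast
  have ey: "cnorm B (e \<boxdot> y) \<le> 2 * cnorm B y" if y: "y \<in> carrier B" for y
  proof -
    note [simp] = IB[OF e] y closed
    have "e \<boxdot> y = (y \<boxplus> e \<boxdot> y) \<boxplus> (-1) \<cdot> y"
      using add_sub_cancel(2)[of "e \<boxdot> y" y] by simp
    then have "cnorm B (e \<boxdot> y) \<le> cnorm B (y \<boxplus> e \<boxdot> y) + cnorm B ((-1) \<cdot> y)"
      using norm_triangle[of "y \<boxplus> e \<boxdot> y" "(-1) \<cdot> y"] by simp
    then show ?thesis using *(1)[OF y] by (simp add: norm_scale)
  qed
  show ?thesis
    by (rule that[OF f]) (simp_all add: *(2,3) ey)
qed

text \<open>Writing \<open>g = N + f\<close> for the ergodic sums attached to \<open>h = a\<^sup>* a\<close>, one has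
  \<open>\<parallel>a g y\<parallel>\<^sup>2 = \<parallel>(g y)\<^sup>* h (g y)\<parallel>\<close>. Here \<open>\<parallel>g\<parallel> \<le> N\<close>, while \<open>h g\<close> is bounded uniformly in \<open>N\<close>, because
  \<open>2 h = (i - h) w\<close> and \<open>w g\<close> is. So \<open>a g\<close> grows only like the square root of \<open>N\<close>.\<close>

lemma ergodic_bound:
  assumes I: "closed_ideal B I" and a: "a \<in> carrier B" "cnorm B a < 1"
    and aa: "cstar B a \<boxdot> a \<in> I"
  obtains f where "f \<in> I" "(cnorm B (of_nat N \<cdot> a \<boxplus> a \<boxdot> f))\<^sup>2 \<le> 2 * real N"
proof -
  define h where "h = cstar B a \<boxdot> a"
  note [simp] = closed a(1)
  have h: "h \<in> carrier B" "cstar B h = h" "h \<in> I"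
    using aa by (simp_all add: h_def star_mult star_star)
  have hn: "cnorm B h < 1"
    unfolding h_def cstar_identity[OF a(1)] using a norm_nonneg[of a]
    by (simp add: power_less_one_iff)
  note S = closed_subspaceD[OF closed_idealD(1)[OF I]]
  obtain w where w: "w \<in> carrier B" and hw: "h \<boxdot> w = \<i> \<cdot> w \<boxplus> (-2) \<cdot> h"
    by (rule cayley_transform_exists[OF h(1) hn])
  note [simp] = h(1) w
  have two_h: "2 \<cdot> h = \<i> \<cdot> w \<boxplus> (-1) \<cdot> (h \<boxdot> w)"
  proof -
    have "\<i> \<cdot> w \<boxplus> (-1) \<cdot> (h \<boxdot> w) = (\<i> \<cdot> w \<boxplus> (-1) \<cdot> \<i> \<cdot> w) \<boxplus> 2 \<cdot> h"
      unfolding hw by (simp add: scale_add scale_scale add_ac)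
    then show ?thesis by (simp only: add_neg zero_add h(1) w closed)
  qed
  have "w \<in> I"
  proof -
    have "\<i> \<cdot> w = (\<i> \<cdot> w \<boxplus> h \<boxdot> w) \<boxplus> (-1) \<cdot> (h \<boxdot> w)"
      by (simp add: add_sub_cancel)
    also have "\<dots> = h \<boxdot> w \<boxplus> 2 \<cdot> h"
      unfolding two_h by (simp add: add_ac)
    finally have "\<i> \<cdot> w = h \<boxdot> w \<boxplus> 2 \<cdot> h" .
    then have "\<i> \<cdot> w \<in> I" using S(3,4) h(3) closed_idealD(3)[OF I] by simp
    then have "(-\<i>) \<cdot> \<i> \<cdot> w \<in> I" by (rule S(3))
    then show ?thesis by (simp add: scale_scale scale_one)
  qed
  have iso: "cnorm B (y \<boxplus> w \<boxdot> y) = cnorm B y" if "y \<in> carrier B" for y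
    by (rule unitary_isometric[OF w cayley_transform_unitary[OF h(1,2) w hw] that])
  obtain f where f: "f \<in> I" and
    bd: "\<forall>y\<in>carrier B. cnorm B (of_nat N \<cdot> y \<boxplus> f \<boxdot> y) \<le> real N * cnorm B y"
      "\<forall>y\<in>carrier B. cnorm B (w \<boxdot> (of_nat N \<cdot> y \<boxplus> f \<boxdot> y)) \<le> 2 * cnorm B y"
    by (rule ergodic_sums[OF I \<open>w \<in> I\<close> iso, of N])
  have [simp]: "f \<in> carrier B" using f S(1) by blast
  define F where "F = of_nat N \<cdot> a \<boxplus> a \<boxdot> f"
  have [simp]: "F \<in> carrier B" by (simp add: F_def)
  \<comment> \<open>\<open>F\<close> is \<open>a g\<close>; testing it on \<open>F\<^sup>*\<close> recovers its norm.\<close>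
  define y where "y = cstar B F"
  have [simp]: "y \<in> carrier B" and yn: "cnorm B y = cnorm B F"
    by (simp_all add: y_def norm_star)
  define z where "z = of_nat N \<cdot> y \<boxplus> f \<boxdot> y"
  have [simp]: "z \<in> carrier B" by (simp add: z_def)
  have nn: "cnorm B F \<ge> 0" "cnorm B z \<ge> 0" "cnorm B (w \<boxdot> z) \<ge> 0" "cnorm B (h \<boxdot> z) \<ge> 0"
    by (simp_all add: norm_nonneg)
  have "F \<boxdot> y = a \<boxdot> z"
    by (simp add: F_def z_def distribs)
  then have Faz: "cnorm B (a \<boxdot> z) = (cnorm B F)\<^sup>2"
    using norm_mult_star[of F] by (simp add: y_def)
  have "(cnorm B (a \<boxdot> z))\<^sup>2 = cnorm B (cstar B z \<boxdot> (h \<boxdot> z))"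
    using cstar_identity[of "a \<boxdot> z"] by (simp add: star_mult h_def mult_assoc)
  also have "\<dots> \<le> cnorm B z * cnorm B (h \<boxdot> z)"
    using norm_mult[of "cstar B z" "h \<boxdot> z"] by (simp add: norm_star)
  finally have aaz: "(cnorm B (a \<boxdot> z))\<^sup>2 \<le> cnorm B z * cnorm B (h \<boxdot> z)" .
  have "cnorm B (h \<boxdot> z) \<le> cnorm B (w \<boxdot> z)"
  proof -
    have "2 \<cdot> (h \<boxdot> z) = \<i> \<cdot> (w \<boxdot> z) \<boxplus> (-1) \<cdot> (h \<boxdot> (w \<boxdot> z))"
      using arg_cong[OF two_h, of "\<lambda>v. v \<boxdot> z"] by (simp add: distribs)
    then have "cnorm B (2 \<cdot> (h \<boxdot> z))
        \<le> cnorm B (\<i> \<cdot> (w \<boxdot> z)) + cnorm B ((-1) \<cdot> (h \<boxdot> (w \<boxdot> z)))"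
      using norm_triangle[of "\<i> \<cdot> (w \<boxdot> z)" "(-1) \<cdot> (h \<boxdot> (w \<boxdot> z))"] by simp
    also have "\<dots> = cnorm B (w \<boxdot> z) + cnorm B (h \<boxdot> (w \<boxdot> z))"
      by (simp add: norm_scale)
    finally have "2 * cnorm B (h \<boxdot> z) \<le> cnorm B (w \<boxdot> z) + cnorm B (h \<boxdot> (w \<boxdot> z))"
      by (simp add: norm_scale)
    moreover have "cnorm B (h \<boxdot> (w \<boxdot> z)) \<le> cnorm B h * cnorm B (w \<boxdot> z)"
      by (simp add: norm_mult)
    moreover have "cnorm B h * cnorm B (w \<boxdot> z) \<le> 1 * cnorm B (w \<boxdot> z)"
      using hn nn by (intro mult_right_mono) simp_all
    ultimately show ?thesis by linarith
  qed
  also have "cnorm B (w \<boxdot> z) \<le> 2 * cnorm B F"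
    using bd(2)[rule_format, of y] by (simp add: z_def yn)
  finally have "cnorm B z * cnorm B (h \<boxdot> z) \<le> (real N * cnorm B F) * (2 * cnorm B F)"
    using bd(1)[rule_format, of y] nn by (intro mult_mono) (simp_all add: z_def yn)
  then have *: "(cnorm B F)\<^sup>2 * (cnorm B F)\<^sup>2 \<le> (2 * real N) * (cnorm B F)\<^sup>2"
    using aaz unfolding Faz by (simp add: power2_eq_square mult_ac)
  then have "(cnorm B F)\<^sup>2 \<le> 2 * real N"
  proof (cases "cnorm B F = 0")
    case False
    then have "0 < (cnorm B F)\<^sup>2" by simp
    with * show ?thesis by (rule mult_right_le_imp_le)
  qed simp
  then show ?thesis using that f unfolding F_def by blast
qed

text \<open>Divide the preceding estimate by \<open>N\<close>: \<open>a + a f / N\<close> tends to zero.\<close>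

lemma mem_closed_ideal_of_star_mult:
  assumes I: "closed_ideal B I" and a: "a \<in> carrier B" "cnorm B a < 1"
    and aa: "cstar B a \<boxdot> a \<in> I"
  shows "a \<in> I"
proof -
  note S = closed_subspaceD[OF closed_idealD(1)[OF I]]
  have "\<exists>b\<in>I. cdist B b a \<le> sqrt (2 / real (Suc n))" for n
  proof -
    define N where "N = Suc n"
    obtain f where f: "f \<in> I" and le: "(cnorm B (of_nat N \<cdot> a \<boxplus> a \<boxdot> f))\<^sup>2 \<le> 2 * real N"
      by (rule ergodic_bound[OF assms])
    have fB: "f \<in> carrier B" using S(1) f by blast
    define b where "b = (- 1 / of_nat N) \<cdot> (a \<boxdot> f)"
    have N: "complex_of_nat N \<noteq> 0" "real N > 0" unfolding N_def by (simp_all del: of_nat_Suc)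
    have "b \<boxplus> (-1) \<cdot> a = (- 1 / of_nat N) \<cdot> (of_nat N \<cdot> a \<boxplus> a \<boxdot> f)"
      unfolding b_def using fB a N by (simp add: scale_add scale_scale closed add_comm)
    then have d: "cdist B b a = cnorm B (of_nat N \<cdot> a \<boxplus> a \<boxdot> f) / real N"
      unfolding cdist_def using fB a N by (simp add: norm_scale closed norm_divide)
    have "(cdist B b a)\<^sup>2 \<le> 2 * real N / (real N)\<^sup>2"
      unfolding d power_divide using le by (intro divide_right_mono) auto
    also have "\<dots> = 2 / real N" using N by (simp add: power2_eq_square)
    finally have "cdist B b a \<le> sqrt (2 / real N)" by (rule real_le_rsqrt)
    moreover have "b \<in> I" unfolding b_def using S(3) closed_idealD(2)[OF I a(1) f] by blast
    ultimately show ?thesis unfolding N_def by blast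
  qed
  then have "\<exists>b. \<forall>n. b n \<in> I \<and> cdist B (b n) a \<le> sqrt (2 / real (Suc n))"
    by (intro choice) blast
  then obtain b where b: "\<And>n. b n \<in> I" "\<And>n. cdist B (b n) a \<le> sqrt (2 / real (Suc n))"
    by blast
  have "(\<lambda>n. sqrt (2 * inverse (real (Suc n)))) \<longlonglongrightarrow> sqrt (2 * 0)"
    by (intro tendsto_intros LIMSEQ_inverse_real_of_nat)
  then have lim: "(\<lambda>n. sqrt (2 / real (Suc n))) \<longlonglongrightarrow> 0"
    by (simp add: divide_inverse)
  have "0 \<le> cdist B (b n) a" for n
    unfolding cdist_def
    by (intro norm_nonneg add_closed scale_closed subsetD[OF S(1) b(1)] a(1))
  then have "cconv B b a"
    unfolding cconv_def using b(2)
    by (intro tendsto_sandwich[OF always_eventually always_eventually tendsto_const lim] allI)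
  then show ?thesis by (rule S(5)[OF b(1) a(1)])
qed

text \<open>For \<open>x\<close> in the ideal, \<open>a = x\<^sup>*\<close> satisfies \<open>a\<^sup>* a = x x\<^sup>* \<in> I\<close>; scaling makes \<open>a\<close> small.\<close>

theorem closed_ideal_star:
  assumes I: "closed_ideal B I" and x: "x \<in> I"
  shows "cstar B x \<in> I"
proof -
  note S = closed_subspaceD[OF closed_idealD(1)[OF I]]
  have xB: "x \<in> carrier B" using S(1) x by blast
  define r where "r = 1 + cnorm B x"
  have r: "r > 0" "cnorm B x < r" using norm_nonneg[OF xB] by (simp_all add: r_def)
  define a where "a = complex_of_real (1 / r) \<cdot> cstar B x"
  have "a \<in> I"
  proof (rule mem_closed_ideal_of_star_mult[OF I])
    show "a \<in> carrier B" by (simp add: a_def xB closed)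
    show "cnorm B a < 1"
      using r unfolding a_def by (simp add: norm_scale xB closed norm_star norm_divide)
    have "cstar B a \<in> I"
      unfolding a_def using x xB S(3) by (simp add: star_scale star_star closed)
    then show "cstar B a \<boxdot> a \<in> I" using \<open>a \<in> carrier B\<close> closed_idealD(3)[OF I] by blast
  qed
  then have "complex_of_real r \<cdot> a \<in> I" by (rule S(3))
  then show ?thesis
    using r xB unfolding a_def by (simp add: scale_scale scale_one closed flip: of_real_mult)
qed

section \<open>Quotients by closed ideals\<close>

lemma closed_ideal_ideal_gen:
  assumes "S \<subseteq> carrier B" shows "closed_ideal B (ideal_gen B S)"
proof -
  have "closed_ideal B (carrier B)"
    unfolding closed_ideal_def closed_subspace_def by (auto simp: closed)
  then have ne: "carrier B \<in> {I. closed_ideal B I \<and> S \<subseteq> I}" using assms by blast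
  then have sub: "ideal_gen B S \<subseteq> carrier B" unfolding ideal_gen_def by blast
  show ?thesis
    unfolding closed_ideal_def closed_subspace_def
  proof (intro conjI ballI allI impI sub)
    show "czero B \<in> ideal_gen B S"
      unfolding ideal_gen_def closed_ideal_def closed_subspace_def by blast
    fix x assume x: "x \<in> ideal_gen B S"
    show "c \<cdot> x \<in> ideal_gen B S" for c
      using x unfolding ideal_gen_def closed_ideal_def closed_subspace_def by blast
    show "x \<boxplus> y \<in> ideal_gen B S" if "y \<in> ideal_gen B S" for y
      using x that unfolding ideal_gen_def closed_ideal_def closed_subspace_def by blast
  next
    fix f x assume x: "x \<in> carrier B" and f: "range f \<subseteq> ideal_gen B S \<and> cconv B f x"
    then show "x \<in> ideal_gen B S"
      unfolding ideal_gen_def using closed_subspaceD(5)[OF closed_idealD(1), of _ f x] by blast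
  next
    fix x i assume "x \<in> carrier B" "i \<in> ideal_gen B S"
    then show "x \<boxdot> i \<in> ideal_gen B S" "i \<boxdot> x \<in> ideal_gen B S"
      unfolding ideal_gen_def closed_ideal_def by blast+
  qed
qed

lemma coset_eq_iff:
  assumes I: "closed_ideal B I" and x: "x \<in> carrier B" and y: "y \<in> carrier B"
  shows "cquot_map B I x = cquot_map B I y \<longleftrightarrow> (\<exists>i\<in>I. y = x \<boxplus> i)"
proof
  note S = closed_subspaceD[OF closed_idealD(1)[OF I]]
  assume "cquot_map B I x = cquot_map B I y"
  moreover have "y \<in> cquot_map B I y"
    unfolding cquot_map_def using S(2) add_zero[OF y] by (metis image_eqI)
  ultimately show "\<exists>i\<in>I. y = x \<boxplus> i" unfolding cquot_map_def by blast
next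
  note S = closed_subspaceD[OF closed_idealD(1)[OF I]]
  assume "\<exists>i\<in>I. y = x \<boxplus> i"
  then obtain i where i: "i \<in> I" "y = x \<boxplus> i" by blast
  have iB: "i \<in> carrier B" using i S(1) by blast
  show "cquot_map B I x = cquot_map B I y"
    unfolding cquot_map_def
  proof (intro equalityI subsetI)
    fix v assume "v \<in> (\<boxplus>) x ` I"
    then obtain j where j: "j \<in> I" "v = x \<boxplus> j" by blast
    have "v = y \<boxplus> ((-1) \<cdot> i \<boxplus> j)"
    proof -
      have "j \<in> carrier B" using j S(1) by blast
      then have "y \<boxplus> ((-1) \<cdot> i \<boxplus> j) = x \<boxplus> ((i \<boxplus> (-1) \<cdot> i) \<boxplus> j)"
        unfolding i(2) using x iB by (simp add: closed add_assoc)
      also have "\<dots> = v"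
        using j(2) iB \<open>j \<in> carrier B\<close> by (simp add: add_neg zero_add)
      finally show ?thesis by simp
    qed
    then show "v \<in> (\<boxplus>) y ` I" using S(3,4) i j by blast
  next
    fix v assume "v \<in> (\<boxplus>) y ` I"
    then obtain j where j: "j \<in> I" "v = y \<boxplus> j" by blast
    then have "v = x \<boxplus> (i \<boxplus> j)" using i S(1) x iB add_assoc by auto
    then show "v \<in> (\<boxplus>) x ` I" using S(4) i j by blast
  qed
qed

lemma coset_memE:
  assumes "closed_ideal B I" "x \<in> carrier B" "v \<in> cquot_map B I x"
  obtains i where "i \<in> I" "i \<in> carrier B" "v = x \<boxplus> i"
  using assms(3) closed_subspaceD(1)[OF closed_idealD(1)[OF assms(1)]]
  unfolding cquot_map_def by blast

lemma coset_self:
  assumes "closed_ideal B I" "x \<in> carrier B" shows "x \<in> cquot_map B I x"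
  using closed_subspaceD(2)[OF closed_idealD(1)[OF assms(1)]] add_zero[OF assms(2)]
  unfolding cquot_map_def by (metis image_eqI)

lemma UN_eq_const: "\<lbrakk>a \<in> M; \<And>x. x \<in> M \<Longrightarrow> f x = c\<rbrakk> \<Longrightarrow> (\<Union>x\<in>M. f x) = c"
  by blast

text \<open>The operations of the quotient are unions over all representatives. Each union is a single
  coset as the operation does not depend on the representative; for the adjoint, this is where
  the ideal has to be self-adjoint.\<close>

lemma cquot_simps:
  assumes I: "closed_ideal B I" and x: "x \<in> carrier B" and y: "y \<in> carrier B"
  shows "cadd (cquot B I) (cquot_map B I x) (cquot_map B I y) = cquot_map B I (x \<boxplus> y)"
    and "cmult (cquot B I) (cquot_map B I x) (cquot_map B I y) = cquot_map B I (x \<boxdot> y)"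
    and "cscale (cquot B I) c (cquot_map B I x) = cquot_map B I (c \<cdot> x)"
    and "cstar (cquot B I) (cquot_map B I x) = cquot_map B I (cstar B x)"
proof -
  note S = closed_subspaceD[OF closed_idealD(1)[OF I]]
  note M = closed_idealD(2,3)[OF I]
  note [simp] = x y closed
  have *: "cquot_map B I (x \<boxplus> i \<boxplus> (y \<boxplus> j)) = cquot_map B I (x \<boxplus> y)"
       "cquot_map B I ((x \<boxplus> i) \<boxdot> (y \<boxplus> j)) = cquot_map B I (x \<boxdot> y)"
    if i: "i \<in> I" "i \<in> carrier B" and j: "j \<in> I" "j \<in> carrier B" for i j
  proof -
    note [simp] = i(2) j(2)
    have "x \<boxplus> i \<boxplus> (y \<boxplus> j) = (x \<boxplus> y) \<boxplus> (i \<boxplus> j)" by (simp add: add_ac)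
    then show "cquot_map B I (x \<boxplus> i \<boxplus> (y \<boxplus> j)) = cquot_map B I (x \<boxplus> y)"
      using coset_eq_iff[OF I, of "x \<boxplus> y" "x \<boxplus> i \<boxplus> (y \<boxplus> j)"] S(4) i(1) j(1) by auto
    have "(x \<boxplus> i) \<boxdot> (y \<boxplus> j) = x \<boxdot> y \<boxplus> (x \<boxdot> j \<boxplus> (i \<boxdot> y \<boxplus> i \<boxdot> j))"
      by (simp add: distribs add_ac)
    moreover have "x \<boxdot> j \<boxplus> (i \<boxdot> y \<boxplus> i \<boxdot> j) \<in> I"
      using S(4) M i(1) j(1) by simp
    ultimately show "cquot_map B I ((x \<boxplus> i) \<boxdot> (y \<boxplus> j)) = cquot_map B I (x \<boxdot> y)"
      using coset_eq_iff[OF I, of "x \<boxdot> y" "(x \<boxplus> i) \<boxdot> (y \<boxplus> j)"] by auto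
  qed
  have **: "cquot_map B I (c \<cdot> (x \<boxplus> i)) = cquot_map B I (c \<cdot> x)"
       "cquot_map B I (cstar B (x \<boxplus> i)) = cquot_map B I (cstar B x)"
    if i: "i \<in> I" "i \<in> carrier B" for i
  proof -
    note [simp] = i(2)
    show "cquot_map B I (c \<cdot> (x \<boxplus> i)) = cquot_map B I (c \<cdot> x)"
      using coset_eq_iff[OF I, of "c \<cdot> x" "c \<cdot> (x \<boxplus> i)"] S(3)[OF i(1), of c] by (auto simp: scale_add)
    show "cquot_map B I (cstar B (x \<boxplus> i)) = cquot_map B I (cstar B x)"
      using coset_eq_iff[OF I, of "cstar B x" "cstar B (x \<boxplus> i)"] closed_ideal_star[OF I i(1)]
      by (auto simp: star_add)
  qed
  note mem = coset_self[OF I x] coset_self[OF I y]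
  show "cadd (cquot B I) (cquot_map B I x) (cquot_map B I y) = cquot_map B I (x \<boxplus> y)"
    and "cmult (cquot B I) (cquot_map B I x) (cquot_map B I y) = cquot_map B I (x \<boxdot> y)"
    unfolding cquot_def calg.simps
    by (intro UN_eq_const[OF mem(1)] UN_eq_const[OF mem(2)];
        elim coset_memE[OF I x] coset_memE[OF I y]; simp add: *)+
  show "cscale (cquot B I) c (cquot_map B I x) = cquot_map B I (c \<cdot> x)"
    and "cstar (cquot B I) (cquot_map B I x) = cquot_map B I (cstar B x)"
    unfolding cquot_def calg.simps
    by (intro UN_eq_const[OF mem(1)]; elim coset_memE[OF I x]; simp add: **)+
qed

text \<open>The map \<open>x + I \<mapsto> x + J\<close>: all representatives of a coset of \<open>I\<close> lie in the same coset of the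
  larger ideal \<open>J\<close>, so the union below has only one member.\<close>

theorem cquot_factor:
  assumes I: "closed_ideal B I" and J: "closed_ideal B J" and "I \<subseteq> J"
  shows "\<exists>\<Psi>. star_hom (cquot B I) (cquot B J) \<Psi> \<and>
           (\<forall>x\<in>carrier B. \<Psi> (cquot_map B I x) = cquot_map B J x)"
proof -
  define \<Psi> where "\<Psi> M = (\<Union>x\<in>M. cquot_map B J x)" for M
  have \<Psi>: "\<Psi> (cquot_map B I x) = cquot_map B J x" if x: "x \<in> carrier B" for x
    unfolding \<Psi>_def
  proof (rule UN_eq_const[OF coset_self[OF I x]])
    fix y assume "y \<in> cquot_map B I x"
    then obtain i where "i \<in> I" "i \<in> carrier B" "y = x \<boxplus> i" by (rule coset_memE[OF I x])
    then show "cquot_map B J y = cquot_map B J x"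
      using coset_eq_iff[OF J x, of y] \<open>I \<subseteq> J\<close> x by (auto simp: closed)
  qed
  have car: "carrier (cquot B K) = cquot_map B K ` carrier B" for K
    by (simp add: cquot_def)
  have "star_hom (cquot B I) (cquot B J) \<Psi>"
    unfolding star_hom_def car
    by (auto simp: cquot_simps[OF I] cquot_simps[OF J] \<Psi> closed)
  with \<Psi> show ?thesis by blast
qed

end

section \<open>Fock covariance implies strong covariance\<close>

text \<open>The zero vector keeps the set nonempty over which \<open>restr_norm\<close> takes its supremum; the
  supremum of the empty set of reals is unspecified, so the norm of the zero operator depends on
  this.\<close>

lemma zero_mem_X_sub:
  assumes "product_system G P X" shows "(\<lambda>_. 0) \<in> X_sub G P X F"
proof -
  have "0 \<in> X r" if "r \<in> P" for r
    using assms that unfolding product_system_def closed_subspace_def bounded_ops_def by auto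
  then show ?thesis
    unfolding X_sub_def fock_space_def using closure_subset span_zero by fastforce
qed

lemma restr_norm_zero:
  fixes P :: "'g set" and X :: "'g \<Rightarrow> ('h::chilbert_space \<Rightarrow>\<^sub>L 'h) set"
  assumes "product_system G P X" shows "restr_norm P (X_sub G P X F) (\<lambda>_ _. 0) = 0"
proof -
  have z: "fock_norm P (\<lambda>_. 0 :: 'h \<Rightarrow>\<^sub>L 'h) = 0"
    by (simp add: fock_norm_def fock_inner_def)
  have "(\<lambda>_. 0) \<in> {\<eta> \<in> X_sub G P X F. fock_norm P \<eta> \<le> 1}"
    using zero_mem_X_sub[OF assms] z by simp
  then show ?thesis
    unfolding restr_norm_def z by (intro cSUP_const) blast
qed

theorem proposition4p15:
  fixes G :: "('g, 'x) monoid_scheme" and P :: "'g set"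
    and X :: "'g \<Rightarrow> ('h::chilbert_space \<Rightarrow>\<^sub>L 'h) set"
    and T :: "('a, 'y) calg_scheme" and tt :: "'g \<Rightarrow> ('h \<Rightarrow>\<^sub>L 'h) \<Rightarrow> 'a"
    and C :: "('c, 'z) calg_scheme" and u :: "'g \<Rightarrow> 'c"
    and ten :: "'k::chilbert_space \<Rightarrow> 'l::chilbert_space \<Rightarrow> 'm::chilbert_space"
    and \<pi> :: "'a \<Rightarrow> 'k \<Rightarrow>\<^sub>L 'k" and \<rho> :: "'c \<Rightarrow> 'l \<Rightarrow>\<^sub>L 'l"
  assumes "group G" and "submonoid P G" and "product_system G P X"
    and "toeplitz_algebra G P X T tt"
    and "max_group_cstar G C u"
    and "hilbert_tensor ten" and "faithful_rep T \<pi>" and "faithful_rep C \<rho>"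
  shows "\<exists>\<Psi>. star_hom (cquot T (fock_cov_ideal G P X T tt C u ten \<pi> \<rho>))
                     (cquot T (strong_cov_ideal G P X T tt C u ten \<pi> \<rho>)) \<Psi> \<and>
             (\<forall>x\<in>carrier T.
                \<Psi> (cquot_map T (fock_cov_ideal G P X T tt C u ten \<pi> \<rho>) x)
                  = cquot_map T (strong_cov_ideal G P X T tt C u ten \<pi> \<rho>) x)"
proof -
  interpret cstar_algebra T
    using assms(4) by (simp add: toeplitz_algebra_def)
  let ?SF = "{b \<in> spectral_subspace P X T tt C u ten \<pi> \<rho> \<one>\<^bsub>G\<^esub>.
     fock_star G P X T tt b = czero (fock_ops P X)}"
  have "?SF \<subseteq> I_sc G P X T tt C u ten \<pi> \<rho>"
    unfolding I_sc_def by (auto simp: fock_ops_def restr_norm_zero[OF assms(3)])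
  then have "fock_cov_ideal G P X T tt C u ten \<pi> \<rho> \<subseteq> strong_cov_ideal G P X T tt C u ten \<pi> \<rho>"
    unfolding fock_cov_ideal_def strong_cov_ideal_def ideal_gen_def by blast
  moreover have "closed_ideal T (fock_cov_ideal G P X T tt C u ten \<pi> \<rho>)"
    unfolding fock_cov_ideal_def spectral_subspace_def
    by (intro closed_ideal_ideal_gen) blast
  moreover have "closed_ideal T (strong_cov_ideal G P X T tt C u ten \<pi> \<rho>)"
    unfolding strong_cov_ideal_def I_sc_def spectral_subspace_def
    by (intro closed_ideal_ideal_gen) blast
  ultimately show ?thesis
    by (intro cquot_factor)
qed

end
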